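(* Let $M$ and $N$ be finitely generated monoids, each having only finitely many left ideals and finitely many right ideals, and suppose $M$ and $N$ are quasi-isometric. If $M$ is finitely presented, then $N$ is finitely presented.
   Context: For a semigroup $S$ generated by a finite set $A$, define $d_A(x,y)=\inf\{|w|: w\in A^*,\ xw=y\}$, where $A^*$ is the free monoid on $A$ (the empty word allowed) and $\inf\emptyset=\infty$; $(S,d_A)$ is a semimetric space (a set with a function to $\mathbb{R}^{\ge0}\cup\{\infty\}$ vanishing exactly on the diagonal and satisfying the triangle inequality, not necessarily symmetric). A map $f:X\to X'$ between semimetric spaces is a quasi-isometry if there exist constants $1\le\lambda<\infty$, $0<\epsilon<\infty$, $0\le\mu<\infty$ such that $\frac1\lambda d(x,y)-\epsilon\le d'(f(x),f(y))\le\lambda d(x,y)+\epsilon$ for all $x,y\in X$, and for every $x'\in X'$ there is $x\in X$ with $\max(d'(x',f(x)),d'(f(x),x'))\le\mu$. Finitely generated semigroups (or monoids) $S,T$ are quasi-isometric if $(S,d_A)$ and $(T,d_B)$ are quasi-isometric for some finite generating sets $A$ of $S$ and $B$ of $T$ (this does not depend on the choice of finite generating sets). *)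

theory Defs
  imports Main "HOL-Library.Extended_Real"
begin

definition generates :: "'a::monoid_mult set \<Rightarrow> bool" where
  "generates A \<longleftrightarrow> (\<forall>x::'a. \<exists>w. set w \<subseteq> A \<and> prod_list w = x)"

definition fin_generated :: "'a::monoid_mult itself \<Rightarrow> bool" where
  "fin_generated _ \<longleftrightarrow> (\<exists>A::'a set. finite A \<and> generates A)"

text \<open>The semimetric d_A(x,y) = inf of lengths of words w over A with x w = y
  (infimum of the empty set is infinity).\<close>

definition dA :: "'a::monoid_mult set \<Rightarrow> 'a \<Rightarrow> 'a \<Rightarrow> enat" where
  "dA A x y = Inf {enat (length w) | w. set w \<subseteq> A \<and> x * prod_list w = y}"

definition quasi_isometry ::
  "('a \<Rightarrow> 'a \<Rightarrow> enat) \<Rightarrow> ('b \<Rightarrow> 'b \<Rightarrow> enat) \<Rightarrow> ('a \<Rightarrow> 'b) \<Rightarrow> bool" where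
  "quasi_isometry d d' f \<longleftrightarrow>
     (\<exists>(lam::real) (\<epsilon>::real) (\<mu>::real). 1 \<le> lam \<and> 0 < \<epsilon> \<and> 0 \<le> \<mu> \<and>
        (\<forall>x y. ereal (1 / lam) * ereal_of_enat (d x y) - ereal \<epsilon> \<le> ereal_of_enat (d' (f x) (f y))
             \<and> ereal_of_enat (d' (f x) (f y)) \<le> ereal lam * ereal_of_enat (d x y) + ereal \<epsilon>) \<and>
        (\<forall>x'. \<exists>x. ereal_of_enat (max (d' x' (f x)) (d' (f x) x')) \<le> ereal \<mu>))"

definition monoids_quasi_isometric :: "'a::monoid_mult itself \<Rightarrow> 'b::monoid_mult itself \<Rightarrow> bool" where
  "monoids_quasi_isometric _ _ \<longleftrightarrow>
     (\<exists>(A::'a set) (B::'b set) (f::'a \<Rightarrow> 'b). finite A \<and> generates A \<and> finite B \<and> generates B \<and>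
        quasi_isometry (dA A) (dA B) f)"

definition left_ideal :: "'a::monoid_mult set \<Rightarrow> bool" where
  "left_ideal I \<longleftrightarrow> I \<noteq> {} \<and> (\<forall>m x. x \<in> I \<longrightarrow> m * x \<in> I)"

definition right_ideal :: "'a::monoid_mult set \<Rightarrow> bool" where
  "right_ideal I \<longleftrightarrow> I \<noteq> {} \<and> (\<forall>m x. x \<in> I \<longrightarrow> x * m \<in> I)"

inductive thue_cong :: "('x list \<times> 'x list) set \<Rightarrow> 'x list \<Rightarrow> 'x list \<Rightarrow> bool" for R where
  step: "(u, v) \<in> R \<Longrightarrow> thue_cong R (p @ u @ q) (p @ v @ q)"
| refl: "thue_cong R w w"
| sym: "thue_cong R u v \<Longrightarrow> thue_cong R v u"
| trans: "thue_cong R u v \<Longrightarrow> thue_cong R v w \<Longrightarrow> thue_cong R u w"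

definition fin_presented :: "'a::monoid_mult itself \<Rightarrow> bool" where
  "fin_presented _ \<longleftrightarrow>
     (\<exists>(X::nat set) (g::nat \<Rightarrow> 'a) (R::(nat list \<times> nat list) set).
        finite X \<and> finite R \<and> R \<subseteq> lists X \<times> lists X \<and>
        (\<forall>m::'a. \<exists>w \<in> lists X. prod_list (map g w) = m) \<and>
        (\<forall>u \<in> lists X. \<forall>v \<in> lists X.
            prod_list (map g u) = prod_list (map g v) \<longleftrightarrow> thue_cong R u v))"

end

theory Submission
  imports Defs
begin

text \<open>
  Finitely many left ideals make finite presentability a property of the right Cayley graph: every
  word is congruent, modulo finitely many relations, to one ending in a fixed representative of its
  \<open>\<L>\<close>-class, so that the truth of \<open>x u = x v\<close> for short \<open>u, v\<close> and arbitrary \<open>x\<close> follows from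
  finitely many instances of it. Hence it suffices to connect two parallel directed paths in the
  Cayley graph of \<open>N\<close> by moves exchanging parallel subpaths of bounded length. Such moves are
  obtained by sending the paths to \<open>M\<close> under a quasi-inverse, applying the relations of \<open>M\<close>, and
  coming back; the round trip is undone by bounded moves along the path.
\<close>

section \<open>Thue congruences and values of words\<close>

abbreviation word_val :: "('x \<Rightarrow> 'a::monoid_mult) \<Rightarrow> 'x list \<Rightarrow> 'a" where
  "word_val h w \<equiv> prod_list (map h w)"

lemma thue_cong_ctxt:
  assumes "thue_cong R u v"
  shows "thue_cong R (p @ u @ q) (p @ v @ q)"
  using assms
proof (induction rule: thue_cong.induct)
  case (step u v p' q')
  then have "thue_cong R ((p @ p') @ u @ (q' @ q)) ((p @ p') @ v @ (q' @ q))"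
    by (rule thue_cong.step)
  then show ?case by simp
qed (blast intro: thue_cong.intros)+

lemma thue_cong_append_right: "thue_cong R u v \<Longrightarrow> thue_cong R (u @ q) (v @ q)"
  using thue_cong_ctxt[of R u v "[]" q] by simp

lemma thue_cong_mono:
  assumes "thue_cong R u v" and "R \<subseteq> S"
  shows "thue_cong S u v"
  using assms(1)
  by (induction rule: thue_cong.induct) (use assms(2) in \<open>blast intro: thue_cong.intros\<close>)+

lemma thue_cong_word_val:
  assumes "thue_cong R u v" and "\<forall>(u, v) \<in> R. word_val h u = word_val h v"
  shows "word_val h u = word_val h v"
  using assms(1) by (induction rule: thue_cong.induct) (use assms(2) in auto)

section \<open>Finitely many left ideals, and relations that hold after any prefix\<close>

lemma finite_range_principal_left_ideals:
  assumes "finite {I::'b::monoid_mult set. left_ideal I}"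
  shows "finite (range (\<lambda>x::'b. range (\<lambda>m. m * x)))"
proof (rule finite_subset[OF _ assms])
  show "range (\<lambda>x::'b. range (\<lambda>m. m * x)) \<subseteq> {I. left_ideal I}"
    by (auto simp: left_ideal_def) (metis mult.assoc rangeI)
qed

text \<open>The left ideal of x b is the left ideal of x multiplied by b, so the principal left
  ideals are the states of a finite automaton reading words from left to right. One relation per
  state and letter moves the representative of the state past the letter, leaving a factor on its
  left. The last conjunct puts \<rho> in the left ideal of w, so that an equation w u = w v passes
  to \<rho> u = \<rho> v.\<close>

lemma cong_left_ideal_representatives:
  fixes h :: "'x \<Rightarrow> 'b::monoid_mult"
  assumes ideals: "finite {I::'b set. left_ideal I}"
    and Y: "finite Y" and gen: "\<forall>m. \<exists>w \<in> lists Y. word_val h w = m"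
  shows "\<exists>S P. finite S \<and> S \<subseteq> lists Y \<times> lists Y \<and> (\<forall>(u, v) \<in> S. word_val h u = word_val h v)
    \<and> finite P \<and> P \<subseteq> lists Y
    \<and> (\<forall>w \<in> lists Y. \<exists>\<rho> \<in> P. \<exists>s \<in> lists Y. thue_cong S w (s @ \<rho>)
          \<and> (\<exists>z. word_val h \<rho> = z * word_val h w))"
proof -
  define I where "I x = range (\<lambda>m::'b. m * x)" for x
  have finI: "finite (range I)"
    using finite_range_principal_left_ideals[OF ideals] by (simp add: I_def)
  have selfI: "x \<in> I x" for x
    unfolding I_def by (metis mult_1 rangeI)
  have I_mult: "I (x * b) = (\<lambda>y. y * b) ` I x" for x b
    by (auto simp: I_def image_image mult.assoc)
  define rep where "rep J = (SOME w. w \<in> lists Y \<and> I (word_val h w) = J)" for J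
  have rep: "rep (I x) \<in> lists Y \<and> I (word_val h (rep (I x))) = I x" for x
    unfolding rep_def by (rule someI_ex) (use gen in metis)
  define nxt where "nxt J b = I (word_val h (rep J) * h b)" for J b
  \<comment> \<open>The factor left behind when \<open>rep J\<close> followed by b is rewritten to
    end in the representative of the next state.\<close>
  define pre where
    "pre J b = (SOME s. s \<in> lists Y
      \<and> word_val h s * word_val h (rep (nxt J b)) = word_val h (rep J) * h b)"
    for J b
  have pre: "pre J b \<in> lists Y
    \<and> word_val h (pre J b) * word_val h (rep (nxt J b)) = word_val h (rep J) * h b" for J b
  proof -
    have "I (word_val h (rep (nxt J b))) = nxt J b"
      unfolding nxt_def using rep by blast
    then have "word_val h (rep J) * h b \<in> I (word_val h (rep (nxt J b)))"
      using selfI by (simp add: nxt_def)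
    then obtain m where "word_val h (rep J) * h b = m * word_val h (rep (nxt J b))"
      unfolding I_def by blast
    moreover obtain s where "s \<in> lists Y" "word_val h s = m"
      using gen by blast
    ultimately have "\<exists>s. s \<in> lists Y
        \<and> word_val h s * word_val h (rep (nxt J b)) = word_val h (rep J) * h b"
      by auto
    then show ?thesis
      unfolding pre_def by (rule someI_ex)
  qed
  \<comment> \<open>The ideal \<open>I 1\<close> is the whole monoid, but its representative need
    not be the empty word. A left inverse of its value lets the empty word be rewritten too, which
    starts the induction.\<close>
  obtain e where e: "e \<in> lists Y" "word_val h e * word_val h (rep (I 1)) = 1"
  proof -
    have "1 \<in> I (word_val h (rep (I 1)))"
      using rep selfI by simp
    then obtain m where "1 = m * word_val h (rep (I 1))"
      unfolding I_def by blast
    then show ?thesis using gen that by metis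
  qed
  define T where "T = insert ([], e @ rep (I 1))
    ((\<lambda>(J, b). (rep J @ [b], pre J b @ rep (nxt J b))) ` (range I \<times> Y))"
  have nxtI: "nxt (I x) b = I (x * h b)" for x b
    unfolding nxt_def by (metis I_mult rep)
  have to_rep: "\<exists>s \<in> lists Y. thue_cong T w (s @ rep (I (word_val h w)))" if "w \<in> lists Y" for w
    using that
  proof (induction w rule: rev_induct)
    case Nil
    have "thue_cong T ([] @ [] @ []) ([] @ (e @ rep (I 1)) @ [])"
      by (rule thue_cong.step) (simp add: T_def)
    then show ?case using e by auto
  next
    case (snoc b w)
    let ?J = "I (word_val h w)"
    obtain s where s: "s \<in> lists Y" "thue_cong T w (s @ rep ?J)"
      using snoc by auto
    have "thue_cong T (w @ [b]) (s @ rep ?J @ [b])"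
      using thue_cong_append_right[OF s(2), of "[b]"] by simp
    moreover have "thue_cong T (s @ (rep ?J @ [b]) @ []) (s @ (pre ?J b @ rep (nxt ?J b)) @ [])"
      by (rule thue_cong.step) (use snoc.prems in \<open>auto simp: T_def\<close>)
    ultimately have "thue_cong T (w @ [b]) ((s @ pre ?J b) @ rep (nxt ?J b))"
      by (auto intro: thue_cong.trans)
    moreover have "nxt ?J b = I (word_val h (w @ [b]))"
      by (simp add: nxtI)
    moreover have "s @ pre ?J b \<in> lists Y"
      using s(1) pre by simp
    ultimately show ?case by metis
  qed
  have rep_multiple: "\<exists>z. word_val h (rep (I x)) = z * x" for x
  proof -
    have "word_val h (rep (I x)) \<in> I x"
      using rep selfI by metis
    then show ?thesis by (auto simp: I_def)
  qed
  have "\<exists>\<rho> \<in> rep ` range I. \<exists>s \<in> lists Y. thue_cong T w (s @ \<rho>)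
      \<and> (\<exists>z. word_val h \<rho> = z * word_val h w)" if "w \<in> lists Y" for w
    using to_rep[OF that] rep_multiple[of "word_val h w"]
    by (rule_tac x = "rep (I (word_val h w))" in bexI) blast+
  moreover have "finite T" "finite (rep ` range I)"
    using finI Y by (auto simp: T_def)
  moreover have "T \<subseteq> lists Y \<times> lists Y"
  proof -
    have "a \<in> Y" if "a \<in> set (rep (I x))" for a x
      using rep[of x] that by auto
    moreover have "a \<in> Y" if "a \<in> set (pre J b)" for a J b
      using pre[of J b] that by auto
    ultimately show ?thesis using e(1) by (auto simp: T_def nxt_def)
  qed
  moreover have "\<forall>(u, v) \<in> T. word_val h u = word_val h v"
    using e pre by (auto simp: T_def)
  moreover have "rep ` range I \<subseteq> lists Y"
    using rep by blast
  ultimately show ?thesis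
    by (intro exI[of _ T] exI[of _ "rep ` range I"] conjI ballI) simp_all
qed

text \<open>The prefix p is unbounded, but modulo finitely many relations it ends in one of finitely
  many words \<rho>, and p u = p v forces \<rho> u = \<rho> v. So the true equations between words
  \<rho> u and \<rho> v, with u and v of length at most K, are enough.\<close>

lemma bounded_bigons_finitely_generated:
  fixes h :: "'x \<Rightarrow> 'b::monoid_mult" and K :: nat
  assumes "finite {I::'b set. left_ideal I}"
    and Y: "finite Y" and "\<forall>m. \<exists>w \<in> lists Y. word_val h w = m"
  shows "\<exists>S. finite S \<and> S \<subseteq> lists Y \<times> lists Y \<and> (\<forall>(u, v) \<in> S. word_val h u = word_val h v)
    \<and> (\<forall>p \<in> lists Y. \<forall>u \<in> lists Y. \<forall>v \<in> lists Y. length u \<le> K \<longrightarrow> length v \<le> K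
        \<longrightarrow> word_val h (p @ u) = word_val h (p @ v) \<longrightarrow> thue_cong S (p @ u) (p @ v))"
proof -
  obtain T P where T: "finite T" "T \<subseteq> lists Y \<times> lists Y" "\<forall>(u, v) \<in> T. word_val h u = word_val h v"
    and P: "finite P" "P \<subseteq> lists Y"
    and rep: "\<forall>w \<in> lists Y. \<exists>\<rho> \<in> P. \<exists>s \<in> lists Y. thue_cong T w (s @ \<rho>)
          \<and> (\<exists>z. word_val h \<rho> = z * word_val h w)"
    using cong_left_ideal_representatives[OF assms] by metis
  define W where "W = {w. set w \<subseteq> Y \<and> length w \<le> K}"
  have finW: "finite W" unfolding W_def using Y by (rule finite_lists_length_le)
  define S where "S = T \<union> {(u, v) \<in> (\<lambda>(\<rho>, u, v). (\<rho> @ u, \<rho> @ v)) ` (P \<times> W \<times> W).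
    word_val h u = word_val h v}"
  have "finite S"
  proof -
    have "finite ((\<lambda>(\<rho>, u, v). (\<rho> @ u, \<rho> @ v)) ` (P \<times> W \<times> W))"
      using P(1) finW by simp
    then show ?thesis
      unfolding S_def using T(1) by (auto intro: finite_subset[rotated])
  qed
  moreover have "S \<subseteq> lists Y \<times> lists Y"
  proof -
    have "a \<in> Y" if "\<rho> \<in> P" "a \<in> set \<rho>" for \<rho> a
      using P(2) that by auto
    then show ?thesis
      unfolding S_def W_def using T(2) by (auto simp: subset_iff)
  qed
  moreover have "\<forall>(u, v) \<in> S. word_val h u = word_val h v"
    unfolding S_def using T(3) by auto
  moreover have "thue_cong S (p @ u) (p @ v)"
    if puv: "p \<in> lists Y" "u \<in> lists Y" "v \<in> lists Y" "length u \<le> K" "length v \<le> K"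
      and eq: "word_val h (p @ u) = word_val h (p @ v)" for p u v
  proof -
    obtain \<rho> s z where \<rho>: "\<rho> \<in> P" "thue_cong T p (s @ \<rho>)" "word_val h \<rho> = z * word_val h p"
      using rep puv(1) by blast
    have ps: "thue_cong S p (s @ \<rho>)"
      using \<rho>(2) by (rule thue_cong_mono) (simp add: S_def)
    \<comment> \<open>The value of \<rho> is a left multiple of that of p, so the equation survives
      the exchange of p for \<rho>.\<close>
    have "word_val h (\<rho> @ u) = word_val h (\<rho> @ v)"
      using eq by (simp add: \<rho>(3) mult.assoc)
    moreover have "u \<in> W" "v \<in> W"
      using puv by (auto simp: W_def)
    ultimately have "(\<rho> @ u, \<rho> @ v) \<in> S"
      unfolding S_def using \<rho>(1) by (auto intro: image_eqI[where x = "(\<rho>, u, v)"])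
    then have "thue_cong S (s @ (\<rho> @ u) @ []) (s @ (\<rho> @ v) @ [])"
      by (rule thue_cong.step)
    moreover have "thue_cong S (p @ u) ((s @ \<rho>) @ u)" "thue_cong S (p @ v) ((s @ \<rho>) @ v)"
      using ps by (rule thue_cong_append_right)+
    ultimately show ?thesis
      by simp (blast intro: thue_cong.sym thue_cong.trans)
  qed
  ultimately show ?thesis
    by (intro exI[of _ S] conjI ballI impI) (assumption | fast)+
qed

section \<open>Images of paths under maps between Cayley graphs\<close>

text \<open>The word replacing a letter depends on the vertex x where the edge starts, because the
  vertex map f is not a homomorphism in general.\<close>

fun subst_path :: "('x \<Rightarrow> 'a::monoid_mult) \<Rightarrow> ('a \<Rightarrow> 'x \<Rightarrow> 'y list) \<Rightarrow> 'a \<Rightarrow> 'x list \<Rightarrow> 'y list" where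
  "subst_path g \<phi> x [] = []"
| "subst_path g \<phi> x (a # w) = \<phi> x a @ subst_path g \<phi> (x * g a) w"

lemma subst_path_append:
  "subst_path g \<phi> x (u @ v) = subst_path g \<phi> x u @ subst_path g \<phi> (x * word_val g u) v"
  by (induction u arbitrary: x) (auto simp: mult.assoc)

lemma subst_path_in_lists:
  assumes "\<forall>x. \<forall>a \<in> X. \<phi> x a \<in> lists Y" and "w \<in> lists X"
  shows "subst_path g \<phi> x w \<in> lists Y"
  using assms(2) by (induction w arbitrary: x) (use assms(1) in \<open>auto simp del: in_lists_conv_set\<close>)

lemma length_subst_path_le:
  assumes "\<forall>x. \<forall>a \<in> X. length (\<phi> x a) \<le> C" and "w \<in> lists X"
  shows "length (subst_path g \<phi> x w) \<le> C * length w"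
  using assms(2)
proof (induction w arbitrary: x)
  case (Cons a w)
  then have "length (\<phi> x a) \<le> C" "length (subst_path g \<phi> (x * g a) w) \<le> C * length w"
    using assms(1) by auto
  then show ?case by simp
qed simp

lemma word_val_subst_path:
  assumes "\<forall>x. \<forall>a \<in> X. f x * word_val h (\<phi> x a) = f (x * g a)" and "w \<in> lists X"
  shows "f x * word_val h (subst_path g \<phi> x w) = f (x * word_val g w)"
  using assms(2)
proof (induction w arbitrary: x)
  case (Cons a w)
  have "f x * word_val h (subst_path g \<phi> x (a # w))
      = (f x * word_val h (\<phi> x a)) * word_val h (subst_path g \<phi> (x * g a) w)"
    by (simp add: mult.assoc)
  also have "\<dots> = f (x * word_val g (a # w))"
    using Cons assms(1) by (simp add: mult.assoc)
  finally show ?case .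
qed simp

text \<open>Thue congruences live on all lists; this keeps every intermediate word of a derivation
  over X, as the next induction requires.\<close>

lemma thue_cong_lists_iff:
  assumes "thue_cong R u v" and "R \<subseteq> lists X \<times> lists X"
  shows "u \<in> lists X \<longleftrightarrow> v \<in> lists X"
  using assms(1) by (induction rule: thue_cong.induct) (use assms(2) in auto)

text \<open>Applying a relation u = v after a prefix p changes the image path only between the
  images of p and p u. That segment has length at most C L on either side, so the exchange is a
  bounded move. The word c joins 1 to f 1, because the prefixes of such moves are read from
  1.\<close>

lemma thue_cong_subst_path:
  fixes g :: "'x \<Rightarrow> 'a::monoid_mult" and h :: "'y \<Rightarrow> 'b::monoid_mult"
  assumes R: "R \<subseteq> lists X \<times> lists X" "\<forall>(u, v) \<in> R. word_val g u = word_val g v"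
    and lenR: "\<forall>(u, v) \<in> R. length u \<le> L \<and> length v \<le> L"
    and \<phi>: "\<forall>x. \<forall>a \<in> X. \<phi> x a \<in> lists Y" "\<forall>x. \<forall>a \<in> X. length (\<phi> x a) \<le> C"
      "\<forall>x. \<forall>a \<in> X. f x * word_val h (\<phi> x a) = f (x * g a)"
    and c: "c \<in> lists Y" "word_val h c = f 1"
    and S: "\<forall>p \<in> lists Y. \<forall>u \<in> lists Y. \<forall>v \<in> lists Y. length u \<le> K \<longrightarrow> length v \<le> K
        \<longrightarrow> word_val h (p @ u) = word_val h (p @ v) \<longrightarrow> thue_cong S (p @ u) (p @ v)"
    and K: "C * L \<le> K"
    and uv: "thue_cong R u v" and u: "u \<in> lists X"
  shows "thue_cong S (c @ subst_path g \<phi> 1 u) (c @ subst_path g \<phi> 1 v)"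
  using uv u
proof (induction rule: thue_cong.induct)
  case (step u v p q)
  let ?\<Phi> = "subst_path g \<phi>"
  have in_X: "p \<in> lists X" "u \<in> lists X" "q \<in> lists X" "v \<in> lists X"
    using step R by auto
  let ?p = "c @ ?\<Phi> 1 p" and ?x = "word_val g p"
  note in_Y = subst_path_in_lists[OF \<phi>(1)]
  have len: "length (?\<Phi> ?x w) \<le> K" if "w \<in> lists X" "length w \<le> L" for w
    using length_subst_path_le[OF \<phi>(2) that(1), of g ?x] that(2) K
    by (meson le_trans mult_le_mono2)
  have p_val: "word_val h ?p = f ?x"
    using word_val_subst_path[OF \<phi>(3) in_X(1), of 1] c by simp
  have val: "word_val h (?p @ ?\<Phi> ?x w) = f (?x * word_val g w)" if "w \<in> lists X" for w
    using word_val_subst_path[OF \<phi>(3) that, of ?x] p_val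
    by (simp add: mult.assoc del: append_assoc)
  have eq: "word_val g u = word_val g v"
    using R(2) step.hyps by auto
  have "thue_cong S (?p @ ?\<Phi> ?x u) (?p @ ?\<Phi> ?x v)"
  proof (rule S[rule_format])
    show "?p \<in> lists Y" "?\<Phi> ?x u \<in> lists Y" "?\<Phi> ?x v \<in> lists Y"
      using c(1) in_Y in_X by auto
    show "length (?\<Phi> ?x u) \<le> K" "length (?\<Phi> ?x v) \<le> K"
      using len in_X lenR step.hyps by auto
    show "word_val h (?p @ ?\<Phi> ?x u) = word_val h (?p @ ?\<Phi> ?x v)"
      using val in_X eq by metis
  qed
  \<comment> \<open>As u and v have equal values, the edges of q start at the same vertices in both
    words and have the same image.\<close>
  from thue_cong_append_right[OF this, of "?\<Phi> (?x * word_val g u) q"] show ?case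
    using eq by (simp add: subst_path_append)
next
  case (trans u v w)
  then show ?case
    using thue_cong_lists_iff[OF _ R(1)] thue_cong.trans by metis
next
  case (sym u v)
  then show ?case
    using thue_cong_lists_iff[OF _ R(1)] thue_cong.sym by metis
qed (rule thue_cong.refl)

section \<open>Transfer of a finite presentation along coarsely inverse maps\<close>

lemma finite_presentation_transfer:
  fixes g :: "'x \<Rightarrow> 'a::monoid_mult" and h :: "'y \<Rightarrow> 'b::monoid_mult"
  assumes finR: "finite R" and R: "R \<subseteq> lists X \<times> lists X"
    and genX: "\<forall>m. \<exists>w \<in> lists X. word_val g w = m"
    and presR: "\<forall>u \<in> lists X. \<forall>v \<in> lists X. word_val g u = word_val g v \<longleftrightarrow> thue_cong R u v"
    and ideals: "finite {I::'b set. left_ideal I}" and Y: "finite Y"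
    and genY: "\<forall>m. \<exists>w \<in> lists Y. word_val h w = m"
    and \<phi>: "\<forall>x. \<forall>a \<in> X. \<exists>w \<in> lists Y. length w \<le> C \<and> f x * word_val h w = f (x * g a)"
    and \<psi>: "\<forall>y. \<forall>b \<in> Y. \<exists>w \<in> lists X. length w \<le> C \<and> f' y * word_val g w = f' (y * h b)"
    and \<beta>: "\<forall>y. \<exists>w \<in> lists Y. length w \<le> C \<and> f (f' y) * word_val h w = y"
  shows "\<exists>S. finite S \<and> S \<subseteq> lists Y \<times> lists Y \<and>
    (\<forall>u \<in> lists Y. \<forall>v \<in> lists Y. word_val h u = word_val h v \<longleftrightarrow> thue_cong S u v)"
proof -
  obtain \<phi> where \<phi>: "\<forall>x. \<forall>a \<in> X. \<phi> x a \<in> lists Y" "\<forall>x. \<forall>a \<in> X. length (\<phi> x a) \<le> C"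
      "\<forall>x. \<forall>a \<in> X. f x * word_val h (\<phi> x a) = f (x * g a)"
    using \<phi> by metis
  obtain \<psi> where \<psi>: "\<forall>y. \<forall>b \<in> Y. \<psi> y b \<in> lists X" "\<forall>y. \<forall>b \<in> Y. length (\<psi> y b) \<le> C"
      "\<forall>y. \<forall>b \<in> Y. f' y * word_val g (\<psi> y b) = f' (y * h b)"
    using \<psi> by metis
  obtain \<beta> where \<beta>: "\<And>y. \<beta> y \<in> lists Y" "\<And>y. length (\<beta> y) \<le> C" "\<And>y. f (f' y) * word_val h (\<beta> y) = y"
    using \<beta> by metis
  let ?\<Phi> = "subst_path g \<phi>" and ?\<Psi> = "subst_path h \<psi>"
  obtain c where c: "c \<in> lists Y" "word_val h c = f 1" using genY by metis
  obtain d where d: "d \<in> lists X" "word_val g d = f' 1" using genX by metis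
  obtain L where L: "\<forall>(u, v) \<in> R. length u \<le> L \<and> length v \<le> L"
  proof
    show "\<forall>(u, v) \<in> R. length u \<le> (\<Sum>(u, v)\<in>R. length u + length v)
        \<and> length v \<le> (\<Sum>(u, v)\<in>R. length u + length v)"
    proof clarify
      fix u v assume "(u, v) \<in> R"
      from member_le_sum[OF this, of "\<lambda>(u, v). length u + length v"] finR
      show "length u \<le> (\<Sum>(u, v)\<in>R. length u + length v)
        \<and> length v \<le> (\<Sum>(u, v)\<in>R. length u + length v)" by simp
    qed
  qed
  \<comment> \<open>C L bounds images of relators; C C + C and C + 1 bound the two sides of the move
    that absorbs one more letter; the last summand is the length of the round trip of the empty
    word.\<close>
  define K where "K = C * L + C * C + C + 1 + length (c @ ?\<Phi> 1 d @ \<beta> 1)"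
  obtain S where S: "finite S" "S \<subseteq> lists Y \<times> lists Y" "\<forall>(u, v) \<in> S. word_val h u = word_val h v"
    and bigon: "\<forall>p \<in> lists Y. \<forall>u \<in> lists Y. \<forall>v \<in> lists Y. length u \<le> K \<longrightarrow> length v \<le> K
        \<longrightarrow> word_val h (p @ u) = word_val h (p @ v) \<longrightarrow> thue_cong S (p @ u) (p @ v)"
    using bounded_bigons_finitely_generated[OF ideals Y genY] by metis
  have validR: "\<forall>(u, v) \<in> R. word_val g u = word_val g v"
  proof clarify
    fix u v assume uv: "(u, v) \<in> R"
    then have "thue_cong R u v" using thue_cong.step[of u v R "[]" "[]"] by simp
    with uv R presR show "word_val g u = word_val g v" by blast
  qed
  \<comment> \<open>The round trip of u: c and d correct the base points, and \<beta> leads from the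
    image of the endpoint back to the endpoint, so \<open>F u\<close> has the same value as
    u.\<close>
  define F where "F u = c @ ?\<Phi> 1 (d @ ?\<Psi> 1 u) @ \<beta> (word_val h u)" for u
  note in_Y = subst_path_in_lists[OF \<phi>(1)] and in_X = subst_path_in_lists[OF \<psi>(1)]
  have \<Psi>_val: "word_val g (d @ ?\<Psi> 1 u) = f' (word_val h u)" if "u \<in> lists Y" for u
    using word_val_subst_path[OF \<psi>(3) that, of 1] d by simp
  have F_cong: "thue_cong S (F u) (F v)"
    if "u \<in> lists Y" "v \<in> lists Y" "word_val h u = word_val h v" for u v
  proof -
    have uvX: "d @ ?\<Psi> 1 u \<in> lists X" "d @ ?\<Psi> 1 v \<in> lists X"
      using d in_X that by auto
    then have "thue_cong R (d @ ?\<Psi> 1 u) (d @ ?\<Psi> 1 v)"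
      using presR \<Psi>_val that by metis
    then have "thue_cong S (c @ ?\<Phi> 1 (d @ ?\<Psi> 1 u)) (c @ ?\<Phi> 1 (d @ ?\<Psi> 1 v))"
      using uvX(1)
      by (intro thue_cong_subst_path[OF R validR L \<phi> c bigon]) (auto simp: K_def)
    from thue_cong_append_right[OF this, of "\<beta> (word_val h u)"] show ?thesis
      using that(3) by (simp add: F_def)
  qed
  have F_id: "thue_cong S (F u) u" if "u \<in> lists Y" for u
    using that
  proof (induction u rule: rev_induct)
    \<comment> \<open>The round trip of the empty word is one fixed loop at 1.\<close>
    case Nil
    have "f 1 * word_val h (?\<Phi> 1 d) = f (f' 1)"
      using word_val_subst_path[OF \<phi>(3) d(1), of 1] d(2) by simp
    then have "word_val h (c @ ?\<Phi> 1 d @ \<beta> 1) = 1"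
      using c \<beta>(3)[of 1] by (simp flip: mult.assoc)
    then have "thue_cong S ([] @ (c @ ?\<Phi> 1 d @ \<beta> 1)) ([] @ [])"
      using c d \<beta>(1) in_Y by (intro bigon[rule_format]) (auto simp: K_def simp del: in_lists_conv_set)
    then show ?case by (simp add: F_def)
  next
    case (snoc b u)
    then have ub: "u \<in> lists Y" "b \<in> Y" by auto
    let ?y = "word_val h u" and ?p = "c @ ?\<Phi> 1 (d @ ?\<Psi> 1 u)"
    let ?t = "?\<Phi> (f' ?y) (\<psi> ?y b)"
    have \<psi>X: "\<psi> ?y b \<in> lists X" "length (\<psi> ?y b) \<le> C" using \<psi> ub by auto
    have pX: "d @ ?\<Psi> 1 u \<in> lists X" using d in_X ub by auto
    have F_snoc: "F (u @ [b]) = ?p @ (?t @ \<beta> (?y * h b))"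
      using \<Psi>_val[OF ub(1)] by (simp add: F_def subst_path_append)
    have p_val: "word_val h ?p = f (f' ?y)"
      using word_val_subst_path[OF \<phi>(3) pX, of 1] c(2) \<Psi>_val[OF ub(1)] by simp
    have t_val: "f (f' ?y) * word_val h ?t = f (f' (?y * h b))"
      using word_val_subst_path[OF \<phi>(3) \<psi>X(1), of "f' ?y"] \<psi>(3) ub(2) by simp
    have t_len: "length ?t \<le> C * C"
      using length_subst_path_le[OF \<phi>(2) \<psi>X(1), of g "f' ?y"] \<psi>X(2)
      by (meson le_trans mult_le_mono2)
    \<comment> \<open>Both sides lead from f (f' y) to y b: either along the image of the edge and
      then back by \<beta>, or back by \<beta> first and then along the edge itself.\<close>
    have "thue_cong S (?p @ (?t @ \<beta> (?y * h b))) (?p @ (\<beta> ?y @ [b]))"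
    proof (rule bigon[rule_format])
      show "?p \<in> lists Y" using c in_Y[OF pX] by auto
      show "?t @ \<beta> (?y * h b) \<in> lists Y" using in_Y[OF \<psi>X(1)] \<beta>(1) by auto
      show "\<beta> ?y @ [b] \<in> lists Y" using \<beta>(1)[of ?y] ub by auto
      show "length (?t @ \<beta> (?y * h b)) \<le> K"
        using t_len \<beta>(2)[of "?y * h b"] by (simp add: K_def)
      show "length (\<beta> ?y @ [b]) \<le> K" using \<beta>(2)[of ?y] by (simp add: K_def)
      have "word_val h (?p @ (?t @ \<beta> (?y * h b)))
          = (word_val h ?p * word_val h ?t) * word_val h (\<beta> (?y * h b))"
        by (simp add: mult.assoc)
      also have "\<dots> = ?y * h b" unfolding p_val t_val \<beta>(3) ..
      also have "\<dots> = (word_val h ?p * word_val h (\<beta> ?y)) * h b" unfolding p_val \<beta>(3) ..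
      also have "\<dots> = word_val h (?p @ (\<beta> ?y @ [b]))" by (simp add: mult.assoc)
      finally show "word_val h (?p @ (?t @ \<beta> (?y * h b))) = word_val h (?p @ (\<beta> ?y @ [b]))" .
    qed
    moreover have "?p @ (\<beta> ?y @ [b]) = F u @ [b]" by (simp add: F_def)
    moreover have "thue_cong S (F u @ [b]) (u @ [b])"
      using snoc.IH ub(1) by (intro thue_cong_append_right)
    ultimately show ?case unfolding F_snoc by (metis thue_cong.trans)
  qed
  have "word_val h u = word_val h v \<longleftrightarrow> thue_cong S u v" if "u \<in> lists Y" "v \<in> lists Y" for u v
    using that F_cong F_id thue_cong_word_val[OF _ S(3)] thue_cong.sym thue_cong.trans by metis
  then show ?thesis using S by blast
qed

section \<open>Word semimetrics and quasi-isometries\<close>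

lemma dA_le_iff:
  "dA A x y \<le> enat k \<longleftrightarrow> (\<exists>w. set w \<subseteq> A \<and> length w \<le> k \<and> x * prod_list w = y)"
proof
  let ?D = "{enat (length w) | w. set w \<subseteq> A \<and> x * prod_list w = y}"
  assume le: "dA A x y \<le> enat k"
  \<comment> \<open>A finite bound rules out the empty set, whose infimum is infinity; a nonempty
    set of lengths attains its infimum.\<close>
  then have "?D \<noteq> {}" unfolding dA_def by (metis Inf_empty top_enat_def enat_ord_simps(5) infinity_ileE)
  then have "Inf ?D \<in> ?D" unfolding Inf_enat_def by (metis (mono_tags, lifting) LeastI ex_in_conv)
  then show "\<exists>w. set w \<subseteq> A \<and> length w \<le> k \<and> x * prod_list w = y"
    using le unfolding dA_def by auto
next
  assume "\<exists>w. set w \<subseteq> A \<and> length w \<le> k \<and> x * prod_list w = y"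
  then obtain w where w: "set w \<subseteq> A" "length w \<le> k" "x * prod_list w = y" by blast
  then have "dA A x y \<le> enat (length w)" unfolding dA_def by (intro Inf_lower) auto
  then show "dA A x y \<le> enat k" using w(2) by (meson enat_ord_simps(1) order_trans)
qed

lemma dA_triangle:
  assumes "dA A x y \<le> enat k" and "dA A y z \<le> enat l"
  shows "dA A x z \<le> enat (k + l)"
proof -
  obtain u v where "set u \<subseteq> A" "length u \<le> k" "x * prod_list u = y"
    "set v \<subseteq> A" "length v \<le> l" "y * prod_list v = z"
    using assms unfolding dA_le_iff by blast
  then show ?thesis
    unfolding dA_le_iff by (intro exI[of _ "u @ v"]) (auto simp flip: mult.assoc)
qed

text \<open>The generators A measuring distance and the generators X of the presentation may differ;
  rewriting each letter of A as a fixed word over X stretches lengths by at most a constant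
  factor.\<close>

lemma uniform_word_bound:
  fixes A :: "'a::monoid_mult set"
  assumes "finite A" and "\<forall>m. \<exists>w \<in> lists X. word_val g w = m"
  shows "\<exists>c. \<forall>w. set w \<subseteq> A \<longrightarrow> (\<exists>v \<in> lists X. length v \<le> c * length w \<and> word_val g v = prod_list w)"
proof -
  obtain t where t: "\<And>m. t m \<in> lists X" "\<And>m. word_val g (t m) = m" using assms(2) by metis
  define c where "c = (\<Sum>a\<in>A. length (t a))"
  have c: "length (t a) \<le> c" if "a \<in> A" for a
    unfolding c_def using that assms(1) by (intro member_le_sum) auto
  have "\<exists>v \<in> lists X. length v \<le> c * length w \<and> word_val g v = prod_list w" if "set w \<subseteq> A" for w
    using that
  proof (induction w)
    case (Cons a w)
    then obtain v where "v \<in> lists X" "length v \<le> c * length w" "word_val g v = prod_list w" by auto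
    then show ?case using t[of a] c[of a] Cons.prems by (intro bexI[of _ "t a @ v"]) auto
  qed auto
  then show ?thesis by blast
qed

lemma ereal_of_enat_le_ereal_iff:
  "ereal_of_enat n \<le> ereal r \<longleftrightarrow> 0 \<le> r \<and> n \<le> enat (nat \<lfloor>r\<rfloor>)"
  by (cases n) (auto simp: le_nat_iff le_floor_iff)

text \<open>Only the coarse content is kept: U and V control distances forwards and backwards on
  natural numbers, so the transfer needs no real arithmetic.\<close>

lemma quasi_isometry_bounds:
  assumes "quasi_isometry d d' f"
  obtains U V \<mu> where "\<And>x y k. d x y \<le> enat k \<Longrightarrow> d' (f x) (f y) \<le> enat (U k)"
    and "\<And>x y k. d' (f x) (f y) \<le> enat k \<Longrightarrow> d x y \<le> enat (V k)"
    and "\<And>z. \<exists>x. d' z (f x) \<le> enat \<mu> \<and> d' (f x) z \<le> enat \<mu>"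
proof -
  obtain lam \<epsilon> \<mu> :: real where lam: "1 \<le> lam" "0 < \<epsilon>"
    and lower: "\<And>x y. ereal (1 / lam) * ereal_of_enat (d x y) - ereal \<epsilon> \<le> ereal_of_enat (d' (f x) (f y))"
    and upper: "\<And>x y. ereal_of_enat (d' (f x) (f y)) \<le> ereal lam * ereal_of_enat (d x y) + ereal \<epsilon>"
    and dense: "\<And>z. \<exists>x. ereal_of_enat (max (d' z (f x)) (d' (f x) z)) \<le> ereal \<mu>"
    using assms unfolding quasi_isometry_def by blast
  show ?thesis
  proof (rule that)
    fix x y k assume "d x y \<le> enat k"
    then obtain n where n: "d x y = enat n" "n \<le> k" by (cases "d x y") auto
    have "ereal_of_enat (d' (f x) (f y)) \<le> ereal (lam * real n + \<epsilon>)"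
      using upper[of x y] n by simp
    also have "\<dots> \<le> ereal (lam * real k + \<epsilon>)"
      using n(2) lam by simp
    finally show "d' (f x) (f y) \<le> enat (nat \<lfloor>lam * real k + \<epsilon>\<rfloor>)"
      by (simp only: ereal_of_enat_le_ereal_iff)
  next
    fix x y k assume "d' (f x) (f y) \<le> enat k"
    then obtain n where n: "d' (f x) (f y) = enat n" "n \<le> k" by (cases "d' (f x) (f y)") auto
    have le: "ereal (1 / lam) * ereal_of_enat (d x y) - ereal \<epsilon> \<le> ereal (real n)"
      using lower[of x y] n by simp
    show "d x y \<le> enat (nat \<lfloor>lam * (real k + \<epsilon>)\<rfloor>)"
    proof (cases "d x y")
      case (enat m)
      then have "real m \<le> lam * (real n + \<epsilon>)"
        using le lam by (simp add: field_simps)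
      also have "\<dots> \<le> lam * (real k + \<epsilon>)" using n(2) lam by simp
      finally show ?thesis by (simp add: enat le_nat_iff le_floor_iff)
    next
      \<comment> \<open>An infinite distance would make the lower bound infinite, although it is at
        most n.\<close>
      case infinity
      then show ?thesis using le lam by simp
    qed
  next
    fix z
    show "\<exists>x. d' z (f x) \<le> enat (nat \<lfloor>\<mu>\<rfloor>) \<and> d' (f x) z \<le> enat (nat \<lfloor>\<mu>\<rfloor>)"
      using dense[of z] by (simp only: ereal_of_enat_le_ereal_iff max.bounded_iff) blast
  qed
qed

section \<open>From a quasi-isometry to the data of the transfer\<close>

theorem theorem5p5:
  fixes M :: "'a::monoid_mult itself" and N :: "'b::monoid_mult itself"
  assumes "fin_generated M" and "fin_generated N"
    and "finite {I::'a set. left_ideal I}" and "finite {I::'a set. right_ideal I}"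
    and "finite {I::'b set. left_ideal I}" and "finite {I::'b set. right_ideal I}"
    and "monoids_quasi_isometric M N"
    and "fin_presented M"
  shows "fin_presented N"
proof -
  obtain A :: "'a set" and B :: "'b set" and f where A: "finite A" "generates A"
    and B: "finite B" "generates B" and qi: "quasi_isometry (dA A) (dA B) f"
    using assms(7) unfolding monoids_quasi_isometric_def by blast
  obtain X :: "nat set" and g :: "nat \<Rightarrow> 'a" and R where X: "finite X"
    and R: "finite R" "R \<subseteq> lists X \<times> lists X"
    and genX: "\<forall>m. \<exists>w \<in> lists X. word_val g w = m"
    and presR: "\<forall>u \<in> lists X. \<forall>v \<in> lists X. word_val g u = word_val g v \<longleftrightarrow> thue_cong R u v"
    using assms(8) unfolding fin_presented_def by blast
  \<comment> \<open>Presentations use natural numbers as letters, so B is enumerated.\<close>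
  obtain n and h :: "nat \<Rightarrow> 'b" where h: "B = h ` {i. i < n}"
    using B(1) finite_imp_nat_seg_image_inj_on by metis
  define Y where "Y = {i. i < n}"
  have Y: "finite Y" "B = h ` Y" by (simp_all add: Y_def h)
  have wordY: "\<exists>v \<in> lists Y. length v = length w \<and> word_val h v = prod_list w" if "set w \<subseteq> B" for w
  proof -
    have "w \<in> map h ` lists Y" using that Y(2) by (simp flip: lists_image add: in_lists_conv_set) blast
    then show ?thesis by auto
  qed
  have genY: "\<forall>m. \<exists>w \<in> lists Y. word_val h w = m"
    using B(2) wordY unfolding generates_def by metis
  obtain U V \<mu> where U: "\<And>x y k. dA A x y \<le> enat k \<Longrightarrow> dA B (f x) (f y) \<le> enat (U k)"
    and V: "\<And>x y k. dA B (f x) (f y) \<le> enat k \<Longrightarrow> dA A x y \<le> enat (V k)"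
    and \<mu>: "\<And>z. \<exists>x. dA B z (f x) \<le> enat \<mu> \<and> dA B (f x) z \<le> enat \<mu>"
    using quasi_isometry_bounds[OF qi] by blast
  obtain f' where f': "\<And>z. dA B z (f (f' z)) \<le> enat \<mu>" "\<And>z. dA B (f (f' z)) z \<le> enat \<mu>"
    using \<mu> by metis
  obtain c where c: "\<And>w. set w \<subseteq> A \<Longrightarrow> \<exists>v \<in> lists X. length v \<le> c * length w \<and> word_val g v = prod_list w"
    using uniform_word_bound[OF A(1) genX] by blast
  obtain l where l: "\<And>a. a \<in> X \<Longrightarrow> \<exists>w. set w \<subseteq> A \<and> length w \<le> l \<and> prod_list w = g a"
  proof -
    obtain t where t: "\<And>m. set (t m) \<subseteq> A" "\<And>m. prod_list (t m) = m"
      using A(2) unfolding generates_def by metis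
    have "length (t (g a)) \<le> (\<Sum>a\<in>X. length (t (g a)))" if "a \<in> X" for a
      using that X by (intro member_le_sum) auto
    then show ?thesis using t that by blast
  qed
  \<comment> \<open>The summands bound, in order, the image of an edge of M, the pullback of an edge
    of N rewritten over X, and the correction from f (f' y) to y.\<close>
  define C where "C = U l + c * V (\<mu> + 1 + \<mu>) + \<mu>"
  have dB: "\<exists>w \<in> lists Y. length w \<le> C \<and> x * word_val h w = y"
    if le: "dA B x y \<le> enat k" and k: "k \<le> C" for x y k
  proof -
    obtain w where w: "set w \<subseteq> B" "length w \<le> k" "x * prod_list w = y"
      using le unfolding dA_le_iff by blast
    obtain v where "v \<in> lists Y" "length v = length w" "word_val h v = prod_list w"
      using wordY[OF w(1)] by blast
    then show ?thesis using w k by (intro bexI[of _ v]) auto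
  qed
  have "\<exists>w \<in> lists Y. length w \<le> C \<and> f x * word_val h w = f (x * g a)" if "a \<in> X" for x a
  proof -
    have "dA A x (x * g a) \<le> enat l" using l[OF that] by (auto simp: dA_le_iff)
    then show ?thesis by (intro dB[OF U]) (auto simp: C_def)
  qed
  moreover have "\<exists>w \<in> lists X. length w \<le> C \<and> f' y * word_val g w = f' (y * h b)" if "b \<in> Y" for y b
  proof -
    have "dA B y (y * h b) \<le> enat 1"
      unfolding dA_le_iff using that Y(2) by (intro exI[of _ "[h b]"]) auto
    \<comment> \<open>The directed route f (f' y) to y to y b to f (f' (y b)) has length at most
      \<mu> + 1 + \<mu>, so density is used in both directions.\<close>
    then have "dA A (f' y) (f' (y * h b)) \<le> enat (V (\<mu> + 1 + \<mu>))"
      by (intro V dA_triangle[OF dA_triangle]) (rule f' | assumption)+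
    then obtain w where w: "set w \<subseteq> A" "length w \<le> V (\<mu> + 1 + \<mu>)" "f' y * prod_list w = f' (y * h b)"
      unfolding dA_le_iff by blast
    obtain v where v: "v \<in> lists X" "length v \<le> c * length w" "word_val g v = prod_list w"
      using c[OF w(1)] by blast
    have "length v \<le> C"
      using order_trans[OF v(2) mult_le_mono2[OF w(2), of c]] by (simp add: C_def)
    then show ?thesis using v w by metis
  qed
  moreover have "\<exists>w \<in> lists Y. length w \<le> C \<and> f (f' y) * word_val h w = y" for y
    by (rule dB[OF f'(2)]) (simp add: C_def)
  ultimately have "\<exists>S. finite S \<and> S \<subseteq> lists Y \<times> lists Y \<and>
      (\<forall>u \<in> lists Y. \<forall>v \<in> lists Y. word_val h u = word_val h v \<longleftrightarrow> thue_cong S u v)"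
    by (intro finite_presentation_transfer[OF R genX presR assms(5) Y(1) genY,
          where C = C and f = f and f' = f']) blast+
  then show ?thesis
    unfolding fin_presented_def using Y(1) genY by blast
qed

end
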